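(* Let $Z=(T_i,U_i)_{i\ge1}$ be a non-explosive marked point process with marks in $\mathbb{R}^d$, with associated random measure $\mu$ and $\mathbb{P}$-compensator $\nu$. Assume: (A1) $\mathcal{F}=\mathcal{F}_{\infty-}$ and $\mathbb{F}$ is the smallest filtration for which $\mu$ is optional and $\mathcal{H}\subset\mathcal{F}_0$, where $\mathcal{H}$ is a given initial $\sigma$-field; (A2) there is a kernel, again denoted by $\nu(t,dx)$, such that $\nu(dt,dx)=\nu(t,dx)\,dt$. Let $\mathbb{P}'\sim\mathbb{P}$, let $L$ be the density process of $\mathbb{P}'$ relative to $\mathbb{P}$, and let $Y$ be the non-negative $\mathcal{P}\otimes\mathcal{B}(\mathbb{R}^d)$-measurable function associated with the measure change from $\mathbb{P}$ to $\mathbb{P}'$ (as specified in the context). Then $$\int_0^t\int_{\mathbb{R}^d}Y(s,u)\,\nu(s,du)\,ds<\infty$$ $\mathbb{P}'$-almost surely for all $t>0$, and the density $L$ is given by $$L_t=\exp\Big(-\int_0^t\int_{\mathbb{R}^d}(Y(s,u)-1)\,\nu(s,du)\,ds\Big)\prod_{T_n\le t}Y(T_n,U_n),\qquad t\ge0.$$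
   Context: $(\Omega,\mathcal{F},\mathbb{F},\mathbb{P})$ is a filtered probability space with $\mathbb{F}=(\mathcal{F}_t)_{t\ge0}$ satisfying the usual conditions; $\mathcal{P}$ denotes the predictable $\sigma$-field on $\Omega\times\mathbb{R}_{\ge0}$. A marked point process $Z=(T_i,U_i)_{i\ge1}$ consists of an increasing sequence of stopping times $0<T_1<T_2<\dots$ and a sequence of $\mathbb{R}^d$-valued random variables $U_1,U_2,\dots$; it is non-explosive if $\lim_nT_n=\infty$ almost surely. Its random measure is $\mu([0,t]\times A)=\sum_{i\ge1}\mathbf{1}_{\{U_i\in A\}}\mathbf{1}_{\{T_i\le t\}}$. The compensator of $\mu$ under a probability measure is the unique $\mathbb{F}$-predictable random measure $\nu$ with $\mathbb{E}[\int W\,d\mu]=\mathbb{E}[\int W\,d\nu]$ for every non-negative $\mathcal{P}\otimes\mathcal{B}(\mathbb{R}^d)$-measurable $W$, the expectation being under that measure. $\mathcal{F}_{\infty-}$ is the $\sigma$-field generated by $\bigcup_{t\ge0}\mathcal{F}_t$. The density process $L$ is the unique $\mathbb{P}$-martingale such that $L_t=d\mathbb{P}'|_{\mathcal{F}_t}/d\mathbb{P}|_{\mathcal{F}_t}$ for each $t\ge0$. The function $Y$: whenever $\mathbb{P}'\ll\mathbb{P}$ and (A1), (A2) hold, there exists a non-negative $\mathcal{P}\otimes\mathcal{B}(\mathbb{R}^d)$-measurable function $Y$ such that (i) the compensator of $\mu$ under $\mathbb{P}'$ is $Y(t,u)\,\nu(t,du)\,dt$, and (ii) with $\xi_n:=\inf\{t\ge0:\int_0^t\int_{\mathbb{R}^d}(1-\sqrt{Y(s,u)})^2\,\nu(s,du)\,ds\ge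 n\}$, the process $L$ coincides on $[\![0,\xi_n]\!]$ with $L^n_t=\exp\big(-\int_0^{t\wedge\xi_n}\int_{\mathbb{R}^d}(Y(s,u)-1)\,\nu(s,du)\,ds\big)\prod_{T_i\le t}Y(T_i,U_i)$ for all $n\ge1$. $Y$ denotes such a function. *)

theory Defs
  imports "HOL-Probability.Probability"
begin

text \<open>
  Filtrations are functions on \<^typ>\<open>real\<close> of which only the values at times \<open>t \<ge> 0\<close> matter.
  Processes are curried with the time first, \<open>X t \<omega>\<close>; random fields \<open>Y \<omega> t u\<close>, kernels
  \<open>K \<omega> t\<close> and random measures \<open>\<nu> \<omega>\<close> take \<open>\<omega>\<close> first.  Stopping times have values in
  \<open>[0, \<infinity>]\<close>, represented by \<^typ>\<open>ennreal\<close>.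
\<close>

section \<open>Filtrations and processes\<close>

definition time_filtration :: "'a measure \<Rightarrow> (real \<Rightarrow> 'a measure) \<Rightarrow> bool" where
  "time_filtration M F \<longleftrightarrow>
     (\<forall>t\<ge>0. subalgebra M (F t)) \<and>
     (\<forall>s t. 0 \<le> s \<longrightarrow> s \<le> t \<longrightarrow> sets (F s) \<subseteq> sets (F t))"

definition usual_conditions :: "'a measure \<Rightarrow> (real \<Rightarrow> 'a measure) \<Rightarrow> bool" where
  "usual_conditions M F \<longleftrightarrow>
     time_filtration M F \<and>
     complete_measure M \<and> null_sets M \<subseteq> sets (F 0) \<and>
     (\<forall>t\<ge>0. sets (F t) = (\<Inter>s\<in>{t<..}. sets (F s)))"

definition ext_stopping_time :: "(real \<Rightarrow> 'a measure) \<Rightarrow> ('a \<Rightarrow> ennreal) \<Rightarrow> bool" where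
  "ext_stopping_time F \<tau> \<longleftrightarrow> (\<forall>t\<ge>0. Measurable.pred (F t) (\<lambda>\<omega>. \<tau> \<omega> \<le> ennreal t))"

definition adapted :: "(real \<Rightarrow> 'a measure) \<Rightarrow> (real \<Rightarrow> 'a \<Rightarrow> real) \<Rightarrow> bool" where
  "adapted F X \<longleftrightarrow> (\<forall>t\<ge>0. X t \<in> borel_measurable (F t))"

definition cadlag :: "(real \<Rightarrow> real) \<Rightarrow> bool" where
  "cadlag f \<longleftrightarrow>
     (\<forall>t\<ge>0. (f \<longlongrightarrow> f t) (at_right t)) \<and>
     (\<forall>t>0. \<exists>l. (f \<longlongrightarrow> l) (at_left t))"

text \<open>Martingales are cadlag by convention; this is what makes the density process unique up
  to indistinguishability.\<close>

definition martingale :: "'a measure \<Rightarrow> (real \<Rightarrow> 'a measure) \<Rightarrow> (real \<Rightarrow> 'a \<Rightarrow> real) \<Rightarrow> bool" where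
  "martingale M F X \<longleftrightarrow>
     adapted F X \<and> (AE \<omega> in M. cadlag (\<lambda>t. X t \<omega>)) \<and>
     (\<forall>t\<ge>0. integrable M (X t)) \<and>
     (\<forall>s t. 0 \<le> s \<longrightarrow> s \<le> t \<longrightarrow> (AE \<omega> in M. real_cond_exp M (F s) (X t) \<omega> = X s \<omega>))"

definition density_process ::
  "'a measure \<Rightarrow> 'a measure \<Rightarrow> (real \<Rightarrow> 'a measure) \<Rightarrow> (real \<Rightarrow> 'a \<Rightarrow> real) \<Rightarrow> bool" where
  "density_process M P' F L \<longleftrightarrow>
     martingale M F L \<and>
     (\<forall>t\<ge>0. AE \<omega> in M. L t \<omega> =
        enn2real (RN_deriv (restr_to_subalg M (F t)) (restr_to_subalg P' (F t)) \<omega>))"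

section \<open>Predictable and optional $\sigma$-fields, random measures\<close>

definition predictable_field :: "'a measure \<Rightarrow> (real \<Rightarrow> 'a measure) \<Rightarrow> ('a \<times> real) measure" where
  "predictable_field M F = sigma (space M \<times> {0..})
     ({A \<times> {0} | A. A \<in> sets (F 0)} \<union>
      {A \<times> {s<..t} | A s t. 0 \<le> s \<and> s \<le> t \<and> A \<in> sets (F s)})"

definition optional_field :: "'a measure \<Rightarrow> (real \<Rightarrow> 'a measure) \<Rightarrow> ('a \<times> real) measure" where
  "optional_field M F = sigma (space M \<times> {0..})
     {{z \<in> space M \<times> {0..}. X (snd z) (fst z) \<in> B} | X B.
        adapted F X \<and> (\<forall>\<omega>\<in>space M. cadlag (\<lambda>t. X t \<omega>)) \<and> B \<in> sets borel}"

text \<open>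
  Random measures on \<open>[0, \<infinity>) \<times> E\<close> are families of Borel measures on \<open>\<real> \<times> E\<close>
  without mass at negative times.  Such a measure is \<open>\<Sigma>\<close>-measurable (\<open>\<Sigma>\<close> the predictable or the
  optional field) if \<open>(\<omega>, t) \<mapsto> \<integral>\<^bsub>[0,t] \<times> E\<^esub> W d\<nu>\<close> is \<open>\<Sigma>\<close>-measurable for every non-negative
  \<open>\<Sigma> \<otimes> \<B>(E)\<close>-measurable \<open>W\<close>.
\<close>

definition random_measure_wrt ::
  "'a measure \<Rightarrow> ('a \<times> real) measure \<Rightarrow> ('a \<Rightarrow> (real \<times> 'e::euclidean_space) measure) \<Rightarrow> bool" where
  "random_measure_wrt M \<Sigma> \<nu> \<longleftrightarrow>
     (\<forall>\<omega>\<in>space M. sets (\<nu> \<omega>) = sets borel \<and> emeasure (\<nu> \<omega>) ({..<0} \<times> UNIV) = 0) \<and>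
     (\<forall>W :: ('a \<times> real) \<times> 'e \<Rightarrow> ennreal. W \<in> borel_measurable (\<Sigma> \<Otimes>\<^sub>M borel) \<longrightarrow>
        (\<lambda>(\<omega>, t). \<integral>\<^sup>+(s, u). W ((\<omega>, s), u) * indicator {0..t} s \<partial>\<nu> \<omega>)
          \<in> borel_measurable \<Sigma>)"

abbreviation predictable_random_measure ::
  "'a measure \<Rightarrow> (real \<Rightarrow> 'a measure) \<Rightarrow> ('a \<Rightarrow> (real \<times> 'e::euclidean_space) measure) \<Rightarrow> bool" where
  "predictable_random_measure M F \<nu> \<equiv> random_measure_wrt M (predictable_field M F) \<nu>"

abbreviation optional_random_measure ::
  "'a measure \<Rightarrow> (real \<Rightarrow> 'a measure) \<Rightarrow> ('a \<Rightarrow> (real \<times> 'e::euclidean_space) measure) \<Rightarrow> bool" where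
  "optional_random_measure M F \<nu> \<equiv> random_measure_wrt M (optional_field M F) \<nu>"

text \<open>\<open>Q\<close> is the probability measure under which \<open>\<nu>\<close> is the compensator of \<open>\<mu>\<close>.
  A compensator is determined only up to \<open>Q\<close>-indistinguishability, hence the relation.\<close>

definition is_compensator ::
  "'a measure \<Rightarrow> (real \<Rightarrow> 'a measure) \<Rightarrow> ('a \<Rightarrow> (real \<times> 'e::euclidean_space) measure)
     \<Rightarrow> ('a \<Rightarrow> (real \<times> 'e) measure) \<Rightarrow> bool" where
  "is_compensator Q F \<mu> \<nu> \<longleftrightarrow>
     predictable_random_measure Q F \<nu> \<and>
     (\<forall>W :: ('a \<times> real) \<times> 'e \<Rightarrow> ennreal.
        W \<in> borel_measurable (predictable_field Q F \<Otimes>\<^sub>M borel) \<longrightarrow>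
        (\<integral>\<^sup>+\<omega>. (\<integral>\<^sup>+(t, u). W ((\<omega>, t), u) \<partial>\<mu> \<omega>) \<partial>Q) =
        (\<integral>\<^sup>+\<omega>. (\<integral>\<^sup>+(t, u). W ((\<omega>, t), u) \<partial>\<nu> \<omega>) \<partial>Q))"

text \<open>
  Only joint measurability is asked of a kernel; predictability enters through the random measure
  \<open>K(t, du) dt\<close>, see \<open>has_time_kernel\<close>.
\<close>

definition time_kernel :: "'a measure \<Rightarrow> ('a \<Rightarrow> real \<Rightarrow> 'e::euclidean_space measure) \<Rightarrow> bool" where
  "time_kernel M K \<longleftrightarrow>
     (\<forall>\<omega>\<in>space M. \<forall>t\<ge>0. sets (K \<omega> t) = sets borel) \<and>
     (\<forall>A\<in>sets borel. (\<lambda>(\<omega>, t). emeasure (K \<omega> t) A)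
        \<in> borel_measurable (M \<Otimes>\<^sub>M restrict_space borel {0..}))"

text \<open>
  \<open>\<nu>(dt, du) = Y(t, u) K(t, du) dt\<close> almost surely.  Time integrals are taken over
  \<^const>\<open>lebesgue\<close> rather than \<^const>\<open>lborel\<close>: \<open>K \<omega> t\<close> may fail to be finite for \<open>t\<close> in a null set,
  where the inner integral need not depend on \<open>t\<close> in a Borel measurable way.
\<close>

definition has_time_kernel ::
  "'a measure \<Rightarrow> ('a \<Rightarrow> (real \<times> 'e::euclidean_space) measure) \<Rightarrow>
     ('a \<Rightarrow> real \<Rightarrow> 'e \<Rightarrow> real) \<Rightarrow> ('a \<Rightarrow> real \<Rightarrow> 'e measure) \<Rightarrow> bool" where
  "has_time_kernel Q \<nu> Y K \<longleftrightarrow>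
     (AE \<omega> in Q. \<forall>B\<in>sets borel. emeasure (\<nu> \<omega>) B =
        (\<integral>\<^sup>+t\<in>{0..}. (\<integral>\<^sup>+u. ennreal (Y \<omega> t u) * indicator B (t, u) \<partial>K \<omega> t) \<partial>lebesgue))"

section \<open>Marked point processes\<close>

text \<open>
  The sequence \<open>(T\<^sub>i, U\<^sub>i)\<close> is indexed from 0 here.  As usual \<open>T i \<omega> = \<infinity>\<close>
  means that there are at most \<open>i\<close> points, so strict monotonicity is asked below \<open>\<infinity>\<close> only.
\<close>

definition marked_point_process ::
  "'a measure \<Rightarrow> (real \<Rightarrow> 'a measure) \<Rightarrow> (nat \<Rightarrow> 'a \<Rightarrow> ennreal) \<Rightarrow>
     (nat \<Rightarrow> 'a \<Rightarrow> 'e::euclidean_space) \<Rightarrow> bool" where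
  "marked_point_process M F T U \<longleftrightarrow>
     (\<forall>i. ext_stopping_time F (T i)) \<and> (\<forall>i. U i \<in> borel_measurable M) \<and>
     (\<forall>\<omega>\<in>space M. 0 < T 0 \<omega> \<and>
        (\<forall>i. T i \<omega> \<le> T (Suc i) \<omega> \<and> (T i \<omega> < \<infinity> \<longrightarrow> T i \<omega> < T (Suc i) \<omega>)))"

definition non_explosive :: "'a measure \<Rightarrow> (nat \<Rightarrow> 'a \<Rightarrow> ennreal) \<Rightarrow> bool" where
  "non_explosive M T \<longleftrightarrow> (AE \<omega> in M. (\<lambda>i. T i \<omega>) \<longlonglongrightarrow> \<infinity>)"

text \<open>The sum of the unit masses at \<open>(T i \<omega>, U i \<omega>)\<close> over all \<open>i\<close> with \<open>T i \<omega> < \<infinity>\<close>.\<close>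

definition mpp_measure ::
  "(nat \<Rightarrow> 'a \<Rightarrow> ennreal) \<Rightarrow> (nat \<Rightarrow> 'a \<Rightarrow> 'e::euclidean_space) \<Rightarrow> 'a \<Rightarrow> (real \<times> 'e) measure" where
  "mpp_measure T U \<omega> =
     distr (count_space {i. T i \<omega> < \<infinity>}) borel (\<lambda>i. (enn2real (T i \<omega>), U i \<omega>))"

lemma emeasure_mpp_measure:
  assumes "A \<in> sets borel" and t: "0 \<le> t"
  shows "emeasure (mpp_measure T U \<omega>) ({0..t} \<times> A) =
    (\<Sum>i. indicator A (U i \<omega>) * indicator {..ennreal t} (T i \<omega>))"
proof -
  let ?I = "{i. T i \<omega> < \<infinity>}" and ?f = "\<lambda>i. (enn2real (T i \<omega>), U i \<omega>)"
  have B: "{0..t} \<times> A \<in> sets borel"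
    using assms(1) by (simp add: borel_prod[symmetric])
  have le: "enn2real x \<le> t \<longleftrightarrow> x \<le> ennreal t" if "x < \<infinity>" for x :: ennreal
    using that t by (cases x) auto
  have "emeasure (mpp_measure T U \<omega>) ({0..t} \<times> A) =
      (\<integral>\<^sup>+x. indicator ({0..t} \<times> A) x \<partial>mpp_measure T U \<omega>)"
    using B by (simp add: mpp_measure_def)
  also have "\<dots> = (\<integral>\<^sup>+i. indicator ({0..t} \<times> A) (?f i) \<partial>count_space ?I)"
    unfolding mpp_measure_def using B by (subst nn_integral_distr) auto
  also have "\<dots> = (\<integral>\<^sup>+i. indicator ({0..t} \<times> A) (?f i) * indicator ?I i \<partial>count_space UNIV)"
    by (subst nn_integral_count_space_indicator[symmetric]) auto
  also have "\<dots> = (\<integral>\<^sup>+i. indicator A (U i \<omega>) * indicator {..ennreal t} (T i \<omega>) \<partial>count_space UNIV)"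
  proof (rule nn_integral_cong)
    fix i
    show "(indicator ({0..t} \<times> A) (?f i) * indicator ?I i :: ennreal) =
        indicator A (U i \<omega>) * indicator {..ennreal t} (T i \<omega>)"
    proof (cases "T i \<omega> < \<infinity>")
      case True
      then show ?thesis using le[OF True] by (auto split: split_indicator)
    next
      case False
      then have "T i \<omega> = \<top>" by (simp add: less_top[symmetric])
      then show ?thesis by (auto split: split_indicator simp: top_unique)
    qed
  qed
  finally show ?thesis
    by (simp add: nn_integral_count_space_nat)
qed

text \<open>
  Minimality is among the filtrations satisfying the usual conditions, to which the ambient
  filtration belongs.
\<close>

definition smallest_filtration ::
  "'a measure \<Rightarrow> 'a measure \<Rightarrow> ('a \<Rightarrow> (real \<times> 'e::euclidean_space) measure) \<Rightarrow>
     (real \<Rightarrow> 'a measure) \<Rightarrow> bool" where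
  "smallest_filtration M H \<mu> F \<longleftrightarrow>
     (let admissible = (\<lambda>G. usual_conditions M G \<and> optional_random_measure M G \<mu> \<and>
                            sets H \<subseteq> sets (G 0))
      in admissible F \<and> (\<forall>G. admissible G \<longrightarrow> (\<forall>t\<ge>0. sets (F t) \<subseteq> sets (G t))))"

section \<open>The function $Y$ of the change of measure\<close>

definition xi ::
  "('a \<Rightarrow> real \<Rightarrow> 'e::euclidean_space \<Rightarrow> real) \<Rightarrow> ('a \<Rightarrow> real \<Rightarrow> 'e measure) \<Rightarrow>
     nat \<Rightarrow> 'a \<Rightarrow> ennreal" where
  "xi Y K n \<omega> = Inf {ennreal t | t. 0 \<le> t \<and>
     (\<integral>\<^sup>+s\<in>{0..t}. (\<integral>\<^sup>+u. ennreal ((1 - sqrt (Y \<omega> s u))\<^sup>2) \<partial>K \<omega> s) \<partial>lebesgue) \<ge> of_nat n}"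

definition stopped_density ::
  "(nat \<Rightarrow> 'a \<Rightarrow> ennreal) \<Rightarrow> (nat \<Rightarrow> 'a \<Rightarrow> 'e::euclidean_space) \<Rightarrow>
     ('a \<Rightarrow> real \<Rightarrow> 'e \<Rightarrow> real) \<Rightarrow> ('a \<Rightarrow> real \<Rightarrow> 'e measure) \<Rightarrow> nat \<Rightarrow> real \<Rightarrow> 'a \<Rightarrow> real" where
  "stopped_density T U Y K n t \<omega> =
     exp (- (LINT s:{0..enn2real (min (ennreal t) (xi Y K n \<omega>))}|lebesgue.
               (LINT u|K \<omega> s. (Y \<omega> s u - 1)))) *
     (\<Prod>i | T i \<omega> \<le> ennreal t. Y \<omega> (enn2real (T i \<omega>)) (U i \<omega>))"

text \<open>
  \<open>Y\<close> describes the change of measure from \<open>M\<close> to \<open>P'\<close>: \<open>Y(t, u) K(t, du) dt\<close> is the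
  \<open>P'\<close>-compensator, and the density process \<open>L\<close> agrees with the \<open>n\<close>-th exponential on the
  stochastic interval from \<open>0\<close> to \<open>xi Y K n\<close>, for all \<open>n \<ge> 1\<close>.
\<close>

definition measure_change_function ::
  "'a measure \<Rightarrow> 'a measure \<Rightarrow> (real \<Rightarrow> 'a measure) \<Rightarrow> (nat \<Rightarrow> 'a \<Rightarrow> ennreal) \<Rightarrow>
     (nat \<Rightarrow> 'a \<Rightarrow> 'e::euclidean_space) \<Rightarrow> ('a \<Rightarrow> real \<Rightarrow> 'e measure) \<Rightarrow>
     (real \<Rightarrow> 'a \<Rightarrow> real) \<Rightarrow> ('a \<Rightarrow> real \<Rightarrow> 'e \<Rightarrow> real) \<Rightarrow> bool" where
  "measure_change_function M P' F T U K L Y \<longleftrightarrow>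
     (\<forall>\<omega>\<in>space M. \<forall>t\<ge>0. \<forall>u. 0 \<le> Y \<omega> t u) \<and>
     (\<lambda>((\<omega>, t), u). Y \<omega> t u) \<in> borel_measurable (predictable_field M F \<Otimes>\<^sub>M borel) \<and>
     (\<exists>\<nu>'. is_compensator P' F (mpp_measure T U) \<nu>' \<and> has_time_kernel P' \<nu>' Y K) \<and>
     (AE \<omega> in M. \<forall>n\<ge>1. \<forall>t\<ge>0. ennreal t \<le> xi Y K n \<omega> \<longrightarrow>
        L t \<omega> = stopped_density T U Y K n t \<omega>)"

end

theory Submission
  imports Defs
begin

text \<open>
  The number of points up to \<open>T n\<close> is at most \<open>n + 1\<close>, so integrating the predictable set
  \<open>{s \<le> T n}\<close> shows that the compensator has finite mass up to \<open>T n\<close>, hence, by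
  non-explosion, on all compact time intervals. This applies under both measures, and
  \<open>(1 - sqrt Y)\<^sup>2 \<le> 1 + Y\<close> then makes the integral defining \<open>xi Y K n\<close> finite on compacts. Thus
  each \<open>t\<close> lies below some \<open>xi Y K n\<close>, where the stopped formula for \<open>L\<close> is the asserted one.
\<close>

text \<open>For a finite simple \<open>h\<close> below \<open>f + g\<close>, the difference
  \<open>h - f\<close> is measurable and lies below \<open>g\<close>, so additivity can be applied
  to \<open>f\<close> and \<open>h - f\<close>. This leaves \<open>g\<close> arbitrary, as is wanted
  for the inner integral of \<open>Y\<close>, whose measurability in time is not at hand.\<close>

lemma nn_integral_add_le:
  assumes f: "f \<in> borel_measurable M"
  shows "(\<integral>\<^sup>+x. f x + g x \<partial>M) \<le> (\<integral>\<^sup>+x. f x \<partial>M) + (\<integral>\<^sup>+x. g x \<partial>M)"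
proof -
  have "integral\<^sup>S M h \<le> (\<integral>\<^sup>+x. f x \<partial>M) + (\<integral>\<^sup>+x. g x \<partial>M)"
    if h: "simple_function M h" "h \<le> (\<lambda>x. f x + g x)" "\<forall>x. h x < \<top>" for h
  proof -
    have hm: "h \<in> borel_measurable M"
      using h(1) by (rule borel_measurable_simple_function)
    \<comment> \<open>In \<open>ennreal\<close> the difference \<top> - \<top> equals \<top>. At
      points where \<open>f\<close> is infinite the bound therefore rests on \<open>h\<close> being
      finite, which is why the supremum is taken over finite simple functions.\<close>
    have le: "h x - f x \<le> g x" for x
    proof (cases "f x = \<top>")
      case True
      then show ?thesis using h(3)[rule_format, of x] by (auto simp: minus_top_ennreal)
    next
      case False
      then show ?thesis
        using le_funD[OF h(2), of x] by (simp add: ennreal_minus_le_iff)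
    qed
    have split: "h x \<le> f x + (h x - f x)" for x
      using ennreal_minus_le_iff[of "h x" "f x" "h x - f x"] by simp
    have "integral\<^sup>S M h = (\<integral>\<^sup>+x. h x \<partial>M)"
      using h(1) by (simp add: nn_integral_eq_simple_integral)
    also have "\<dots> \<le> (\<integral>\<^sup>+x. f x + (h x - f x) \<partial>M)"
      by (intro nn_integral_mono split)
    also have "\<dots> = (\<integral>\<^sup>+x. f x \<partial>M) + (\<integral>\<^sup>+x. h x - f x \<partial>M)"
      using f hm by (intro nn_integral_add) auto
    also have "\<dots> \<le> (\<integral>\<^sup>+x. f x \<partial>M) + (\<integral>\<^sup>+x. g x \<partial>M)"
      by (intro add_left_mono nn_integral_mono le)
    finally show ?thesis .
  qed
  then show ?thesis
    by (subst nn_integral_def_finite) (auto intro!: SUP_least)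
qed

section \<open>Predictable sets and their sections\<close>

lemma space_predictable_field [simp]: "space (predictable_field M F) = space M \<times> {0..}"
  by (simp add: predictable_field_def space_measure_of_conv)

lemma sets_predictable_field:
  assumes "time_filtration M F"
  shows "sets (predictable_field M F) = sigma_sets (space M \<times> {0..})
     ({A \<times> {0} | A. A \<in> sets (F 0)} \<union>
      {A \<times> {s<..t} | A s t. 0 \<le> s \<and> s \<le> t \<and> A \<in> sets (F s)})"
proof -
  have "A \<subseteq> space M" if "0 \<le> s" "A \<in> sets (F s)" for A s
    using assms that sets.sets_into_space[OF that(2)]
    by (auto simp: time_filtration_def subalgebra_def)
  then show ?thesis
    unfolding predictable_field_def by (intro sets_measure_of) (fastforce+)
qed

text \<open>Every generator is a rectangle \<open>A \<times> I\<close>, whose section at time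
  \<open>t\<close> is \<open>A\<close> or empty. Composing with this map turns a predictable process
  into a random variable at a fixed time.\<close>

lemma predictable_section_measurable:
  assumes F: "time_filtration M F" and t: "0 \<le> t"
  shows "(\<lambda>\<omega>. (\<omega>, t)) \<in> measurable M (predictable_field M F)"
proof -
  have F_in: "A \<in> sets M" if "0 \<le> s" "A \<in> sets (F s)" for A s
    using F that by (auto simp: time_filtration_def subalgebra_def)
  show ?thesis
    unfolding predictable_field_def
  proof (rule measurable_measure_of)
    show "{A \<times> {0} | A. A \<in> sets (F 0)} \<union>
      {A \<times> {s<..t} | A s t. 0 \<le> s \<and> s \<le> t \<and> A \<in> sets (F s)} \<subseteq> Pow (space M \<times> {0..})"
      using F_in[THEN sets.sets_into_space] by fastforce
    show "(\<lambda>\<omega>. (\<omega>, t)) \<in> space M \<rightarrow> space M \<times> {0..}"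
      using t by auto
    fix B
    assume "B \<in> {A \<times> {0} | A. A \<in> sets (F 0)} \<union>
      {A \<times> {s<..t} | A s t. 0 \<le> s \<and> s \<le> t \<and> A \<in> sets (F s)}"
    then obtain A s I where A: "B = A \<times> I" "0 \<le> s" "A \<in> sets (F s)"
      by (elim UnE) auto
    then have "(\<lambda>\<omega>. (\<omega>, t)) -` B \<inter> space M = (if t \<in> I then A else {})"
      using sets.sets_into_space[OF F_in[OF A(2,3)]] by auto
    then show "(\<lambda>\<omega>. (\<omega>, t)) -` B \<inter> space M \<in> sets M"
      using F_in[OF A(2,3)] by simp
  qed
qed

text \<open>The complement is the set of times strictly after \<tau>. A rational \<open>q\<close>
  fits between \<tau> and such a time, and the event \<tau> \<le> \<open>q\<close> lies in
  \<open>F q\<close>, so the complement is a countable union of generators.\<close>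

lemma predictable_before_stopping_time:
  assumes F: "time_filtration M F" and \<tau>: "ext_stopping_time F \<tau>"
  shows "{z \<in> space M \<times> {0..}. ennreal (snd z) \<le> \<tau> (fst z)} \<in> sets (predictable_field M F)"
proof -
  let ?A = "\<lambda>q. {\<omega> \<in> space M. \<tau> \<omega> \<le> ennreal q}"
  \<comment> \<open>Generators have bounded time intervals; the integers \<open>k\<close> exhaust
    the half-line after \<open>q\<close>.\<close>
  let ?I = "\<Union>q\<in>\<rat> \<inter> {0..}. \<Union>k\<in>{k::nat. q \<le> real k}. ?A q \<times> {q<..real k}"
  have "?A q \<in> sets (F q)" if "0 \<le> q" for q
  proof -
    have "space (F q) = space M"
      using F that by (auto simp: time_filtration_def subalgebra_def)
    moreover have "{\<omega> \<in> space (F q). \<tau> \<omega> \<le> ennreal q} \<in> sets (F q)"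
      using \<tau> that by (auto simp: ext_stopping_time_def pred_def)
    ultimately show ?thesis by simp
  qed
  then have "?A q \<times> {q<..real k} \<in> sets (predictable_field M F)" if "0 \<le> q" "q \<le> real k" for q k
    unfolding sets_predictable_field[OF F] using that by (intro sigma_sets.Basic) blast
  then have I: "?I \<in> sets (predictable_field M F)"
    by (intro sets.countable_UN' countable_Int1 countable_rat countableI_type) auto
  have eq: "{z \<in> space M \<times> {0..}. \<tau> (fst z) < ennreal (snd z)} = ?I"
  proof (intro equalityI subsetI)
    fix z assume z: "z \<in> {z \<in> space M \<times> {0..}. \<tau> (fst z) < ennreal (snd z)}"
    obtain \<omega> s where [simp]: "z = (\<omega>, s)" by (cases z)
    have s: "\<omega> \<in> space M" "0 \<le> s" "\<tau> \<omega> < ennreal s" using z by auto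
    then obtain r where r: "\<tau> \<omega> = ennreal r" "0 \<le> r" "r < s"
      by (cases "\<tau> \<omega>") (auto simp: ennreal_less_iff)
    obtain q where q: "q \<in> \<rat>" "r < q" "q < s" using Rats_dense_in_real[OF r(3)] by blast
    obtain k :: nat where k: "s \<le> real k" using real_arch_simple by blast
    have "z \<in> ?A q \<times> {q<..real k}"
      using s r q k by (auto intro: ennreal_leI)
    moreover have "q \<in> \<rat> \<inter> {0..}" "k \<in> {k. q \<le> real k}" using q r k by auto
    ultimately show "z \<in> ?I" by blast
  next
    fix z assume "z \<in> ?I"
    then obtain q where q: "0 \<le> q" "fst z \<in> space M" "\<tau> (fst z) \<le> ennreal q" "q < snd z"
      by auto
    then have "\<tau> (fst z) < ennreal (snd z)"
      by (meson ennreal_lessI le_less_trans less_le_trans)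
    with q show "z \<in> {z \<in> space M \<times> {0..}. \<tau> (fst z) < ennreal (snd z)}"
      by (cases z) auto
  qed
  have "(space M \<times> {0..}) - {z \<in> space M \<times> {0..}. \<tau> (fst z) < ennreal (snd z)}
      \<in> sets (predictable_field M F)"
    unfolding eq using sets.compl_sets[OF I] by (simp only: space_predictable_field)
  also have "(space M \<times> {0..}) - {z \<in> space M \<times> {0..}. \<tau> (fst z) < ennreal (snd z)} =
      {z \<in> space M \<times> {0..}. ennreal (snd z) \<le> \<tau> (fst z)}"
    by (auto simp: not_less)
  finally show ?thesis .
qed

section \<open>Counting points and the mass of the compensator\<close>

lemma nn_integral_mpp_measure_le:
  fixes U :: "nat \<Rightarrow> 'a \<Rightarrow> 'e::euclidean_space"
  assumes mono: "\<And>i. T i \<omega> \<le> T (Suc i) \<omega>"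
    and strict: "\<And>i. T i \<omega> < \<infinity> \<Longrightarrow> T i \<omega> < T (Suc i) \<omega>"
  shows "(\<integral>\<^sup>+(s, u). indicator {s. ennreal s \<le> T n \<omega>} s \<partial>mpp_measure T U \<omega>) \<le> of_nat (Suc n)"
proof -
  let ?I = "{i. T i \<omega> < \<infinity>}" and ?g = "\<lambda>i. (enn2real (T i \<omega>), U i \<omega>)"
  have inc: "T i \<omega> \<le> T j \<omega>" if "i \<le> j" for i j
    using mono that by (rule lift_Suc_mono_le)
  \<comment> \<open>An index beyond \<open>n\<close> with a finite time would make
    \<open>T n \<omega>\<close> finite as well, and then strictness gives
    \<open>T n \<omega> < T (Suc n) \<omega> \<le> T i \<omega>\<close>. The case of infinite
    \<open>T n \<omega>\<close> is thus included. Counting from 0, the indices up to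
    \<open>n\<close> give the bound \<open>Suc n\<close>.\<close>
  have le_n: "i \<le> n" if "T i \<omega> < \<infinity>" "T i \<omega> \<le> T n \<omega>" for i
  proof (rule ccontr)
    assume "\<not> i \<le> n"
    then have "T (Suc n) \<omega> \<le> T i \<omega>" "T n \<omega> \<le> T i \<omega>" by (auto intro!: inc)
    with that strict[of n] show False by auto
  qed
  have ind: "indicator {s. ennreal s \<le> T n \<omega>} (enn2real (T i \<omega>)) \<le> (indicator {..n} i :: ennreal)"
    if "i \<in> ?I" for i
    using that le_n[of i] by (auto split: split_indicator)
  have "(\<integral>\<^sup>+(s, u). indicator {s. ennreal s \<le> T n \<omega>} s \<partial>mpp_measure T U \<omega>) =
      (\<integral>\<^sup>+i. (case ?g i of (s, u) \<Rightarrow> indicator {s. ennreal s \<le> T n \<omega>} s) \<partial>count_space ?I)"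
    unfolding mpp_measure_def
    by (rule nn_integral_distr) (simp, simp flip: borel_prod)
  also have "\<dots> \<le> (\<integral>\<^sup>+i. indicator {..n} i \<partial>count_space ?I)"
    using ind by (intro nn_integral_mono) auto
  also have "\<dots> = (\<integral>\<^sup>+i. indicator ({..n} \<inter> ?I) i \<partial>count_space ?I)"
    by (intro nn_integral_cong) (auto split: split_indicator)
  also have "\<dots> = of_nat (card ({..n} \<inter> ?I))"
    by (subst nn_integral_indicator) (auto simp: emeasure_count_space_finite)
  also have "\<dots> \<le> of_nat (Suc n)"
    using card_mono[of "{..n}" "{..n} \<inter> ?I"] by (intro of_nat_mono) auto
  finally show ?thesis .
qed

text \<open>The compensator identity for the indicator of the times up to \<open>T n\<close> bounds
  an expected mass by \<open>n + 1\<close>. The measure \<open>Q\<close> is kept general because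
  both \<open>M\<close> and \<open>P'\<close> are substituted for it, each with its own
  compensator.\<close>

lemma compensator_finite_on_compacts:
  fixes U :: "nat \<Rightarrow> 'a \<Rightarrow> 'e::euclidean_space"
  assumes Q: "prob_space Q" and F: "time_filtration Q F"
    and mpp: "marked_point_process Q F T U" and ne: "non_explosive Q T"
    and comp: "is_compensator Q F (mpp_measure T U) \<nu>"
  shows "AE \<omega> in Q. \<forall>t. emeasure (\<nu> \<omega>) ({0..t} \<times> UNIV) < \<infinity>"
proof -
  interpret prob_space Q by fact
  define S where "S n = {z \<in> space Q \<times> {0..}. ennreal (snd z) \<le> T n (fst z)}" for n
  define W :: "nat \<Rightarrow> ('a \<times> real) \<times> 'e \<Rightarrow> ennreal" where "W n = (\<lambda>(z, u). indicator (S n) z)" for n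
  \<comment> \<open>Predictability of the random measure gives measurability of integrals over
    \<open>{0..t}\<close> with \<open>t\<close> finite. The cutoff at \<open>real k\<close> makes
    \<open>J n k\<close> a section of such a process, so that finite expectation implies almost sure
    finiteness.\<close>
  define J where "J n k \<omega> = (\<integral>\<^sup>+(s, u). W n ((\<omega>, s), u) * indicator {0..real k} s \<partial>\<nu> \<omega>)"
    for n k :: nat and \<omega>
  have pm: "\<forall>\<omega>\<in>space Q. sets (\<nu> \<omega>) = sets borel"
    using comp by (auto simp: is_compensator_def random_measure_wrt_def)
  have S: "S n \<in> sets (predictable_field Q F)" for n
    unfolding S_def using mpp
    by (intro predictable_before_stopping_time[OF F]) (auto simp: marked_point_process_def)
  have W: "W n \<in> borel_measurable (predictable_field Q F \<Otimes>\<^sub>M borel)" for n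
    unfolding W_def using S[of n] by measurable
  have Jm: "J n k \<in> borel_measurable Q" for n k
  proof -
    have "(\<lambda>(\<omega>, t). \<integral>\<^sup>+(s, u). W n ((\<omega>, s), u) * indicator {0..t} s \<partial>\<nu> \<omega>)
          \<in> borel_measurable (predictable_field Q F)"
      using comp W[of n] by (auto simp: is_compensator_def random_measure_wrt_def)
    from measurable_compose[OF predictable_section_measurable[OF F, of "real k"] this]
    show ?thesis by (simp add: J_def[abs_def])
  qed
  have fin: "AE \<omega> in Q. J n k \<omega> \<noteq> \<infinity>" for n k
  proof (rule nn_integral_PInf_AE[OF Jm])
    have "(\<integral>\<^sup>+\<omega>. J n k \<omega> \<partial>Q) \<le> (\<integral>\<^sup>+\<omega>. (\<integral>\<^sup>+(s, u). W n ((\<omega>, s), u) \<partial>\<nu> \<omega>) \<partial>Q)"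
      unfolding J_def by (intro nn_integral_mono) (auto split: split_indicator)
    also have "\<dots> = (\<integral>\<^sup>+\<omega>. (\<integral>\<^sup>+(s, u). W n ((\<omega>, s), u) \<partial>mpp_measure T U \<omega>) \<partial>Q)"
      using comp W[of n] by (simp add: is_compensator_def)
    also have "\<dots> \<le> (\<integral>\<^sup>+\<omega>. of_nat (Suc n) \<partial>Q)"
    proof (rule nn_integral_mono)
      fix \<omega> assume "\<omega> \<in> space Q"
      then have "(\<integral>\<^sup>+(s, u). indicator {s. ennreal s \<le> T n \<omega>} s \<partial>mpp_measure T U \<omega>) \<le> of_nat (Suc n)"
        using mpp by (intro nn_integral_mpp_measure_le) (auto simp: marked_point_process_def)
      moreover have "(\<integral>\<^sup>+(s, u). W n ((\<omega>, s), u) \<partial>mpp_measure T U \<omega>) \<le>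
          (\<integral>\<^sup>+(s, u). indicator {s. ennreal s \<le> T n \<omega>} s \<partial>mpp_measure T U \<omega>)"
        by (intro nn_integral_mono) (auto simp: W_def S_def split: split_indicator)
      ultimately show "(\<integral>\<^sup>+(s, u). W n ((\<omega>, s), u) \<partial>mpp_measure T U \<omega>) \<le> of_nat (Suc n)"
        by (rule order_trans[rotated])
    qed
    also have "\<dots> = of_nat (Suc n)"
      by (simp add: emeasure_space_1)
    also have "\<dots> < \<infinity>"
      by (simp add: of_nat_less_top)
    finally show "(\<integral>\<^sup>+\<omega>. J n k \<omega> \<partial>Q) \<noteq> \<infinity>" by simp
  qed
  \<comment> \<open>Only countably many null sets are collected; \<open>n\<close> and
    \<open>k\<close> are chosen afterwards, so the exceptional set does not depend on
    \<open>t\<close>.\<close>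
  have "AE \<omega> in Q. \<forall>n k. J n k \<omega> \<noteq> \<infinity>"
    using fin by (simp add: AE_all_countable)
  with ne[unfolded non_explosive_def] AE_space show ?thesis
  proof eventually_elim
    case (elim \<omega>)
    show ?case
    proof
      fix t :: real
      obtain k :: nat where k: "t \<le> real k" using real_arch_simple by blast
      have "\<forall>\<^sub>F n in sequentially. ennreal t < T n \<omega>"
        using elim(1) by (rule order_tendstoD) simp
      then obtain n where n: "ennreal t < T n \<omega>"
        by (auto simp: eventually_sequentially)
      have s: "ennreal s \<le> T n \<omega>" if "s \<le> t" for s
        using n ennreal_leI[OF that] by auto
      have "emeasure (\<nu> \<omega>) ({0..t} \<times> UNIV) = (\<integral>\<^sup>+z. indicator ({0..t} \<times> UNIV) z \<partial>\<nu> \<omega>)"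
        using pm elim(2) by (subst nn_integral_indicator) (auto simp: borel_prod[symmetric])
      also have "\<dots> \<le> J n k \<omega>"
        unfolding J_def using k elim(2)
        by (intro nn_integral_mono) (auto simp: W_def S_def s split: split_indicator)
      finally show "emeasure (\<nu> \<omega>) ({0..t} \<times> UNIV) < \<infinity>"
        using elim(3) by (metis infinity_ennreal_def less_top order_le_less_trans)
    qed
  qed
qed

section \<open>Time integrals of the kernel and the times \<open>xi\<close>\<close>

lemma has_time_kernel_rectangle:
  assumes "has_time_kernel Q \<nu> Y K"
  shows "AE \<omega> in Q. \<forall>t. emeasure (\<nu> \<omega>) ({0..t} \<times> UNIV) =
    (\<integral>\<^sup>+s\<in>{0..t}. (\<integral>\<^sup>+u. ennreal (Y \<omega> s u) \<partial>K \<omega> s) \<partial>lebesgue)"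
  using assms unfolding has_time_kernel_def
proof eventually_elim
  case (elim \<omega>)
  show ?case
  proof
    fix t :: real
    have "emeasure (\<nu> \<omega>) ({0..t} \<times> UNIV) = (\<integral>\<^sup>+s\<in>{0..}.
        (\<integral>\<^sup>+u. ennreal (Y \<omega> s u) * indicator ({0..t} \<times> UNIV) (s, u) \<partial>K \<omega> s) \<partial>lebesgue)"
      using elim by (simp add: borel_prod[symmetric])
    also have "\<dots> = (\<integral>\<^sup>+s\<in>{0..t}. (\<integral>\<^sup>+u. ennreal (Y \<omega> s u) \<partial>K \<omega> s) \<partial>lebesgue)"
      by (intro nn_integral_cong) (auto split: split_indicator)
    finally show "emeasure (\<nu> \<omega>) ({0..t} \<times> UNIV) =
      (\<integral>\<^sup>+s\<in>{0..t}. (\<integral>\<^sup>+u. ennreal (Y \<omega> s u) \<partial>K \<omega> s) \<partial>lebesgue)" .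
  qed
qed

text \<open>This supplies the measurable summand for \<open>nn_integral_add_le\<close>: a section of
  a jointly measurable map is Borel on the half-line, extends by zero, and remains measurable for
  the completion.\<close>

lemma time_kernel_mass_measurable:
  assumes K: "time_kernel M K" and \<omega>: "\<omega> \<in> space M"
  shows "(\<lambda>s. (\<integral>\<^sup>+u. 1 \<partial>K \<omega> s) * indicator {0..t} s) \<in> borel_measurable lebesgue"
proof -
  \<comment> \<open>Nothing is known about \<open>K \<omega> s\<close> for negative
    \<open>s\<close>; the indicators remove those times.\<close>
  have sp: "space (K \<omega> s) = UNIV" if "0 \<le> s" for s
    using K \<omega> that sets_eq_imp_space_eq[of "K \<omega> s" borel] by (auto simp: time_kernel_def)
  have "(\<lambda>(\<omega>, t). emeasure (K \<omega> t) UNIV)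
        \<in> borel_measurable (M \<Otimes>\<^sub>M restrict_space borel {0..})"
    using K by (auto simp: time_kernel_def)
  from measurable_Pair2[OF this \<omega>]
  have "(\<lambda>s. emeasure (K \<omega> s) UNIV) \<in> borel_measurable (restrict_space borel {0..})"
    by simp
  then have "(\<lambda>s. emeasure (K \<omega> s) UNIV * indicator {0..} s) \<in> borel_measurable borel"
    by (subst (asm) borel_measurable_restrict_space_iff_ennreal) auto
  then have "(\<lambda>s. emeasure (K \<omega> s) UNIV * indicator {0..} s * indicator {0..t} s)
      \<in> borel_measurable borel"
    by measurable
  also have "(\<lambda>s. emeasure (K \<omega> s) UNIV * indicator {0..} s * indicator {0..t} s) =
      (\<lambda>s. (\<integral>\<^sup>+u. 1 \<partial>K \<omega> s) * indicator {0..t} s)"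
    using sp by (auto split: split_indicator)
  finally show ?thesis
    by (intro measurable_completion) simp
qed

text \<open>For \<open>y \<ge> 0\<close> the square \<open>(1 - sqrt y)\<^sup>2\<close> is
  \<open>1 + y - 2 * sqrt y\<close>, hence at most \<open>1 + y\<close>. The two resulting integrals
  are the masses on \<open>{0..t}\<close> of the compensators under \<open>M\<close> and
  \<open>P'\<close>.\<close>

lemma hellinger_integral_le:
  fixes Y :: "'a \<Rightarrow> real \<Rightarrow> 'e::euclidean_space \<Rightarrow> real"
  assumes K: "time_kernel M K" and \<omega>: "\<omega> \<in> space M"
    and Y: "\<And>s u. 0 \<le> s \<Longrightarrow> 0 \<le> Y \<omega> s u"
    and Ym: "(\<lambda>((\<omega>, t), u). Y \<omega> t u) \<in> borel_measurable (predictable_field M F \<Otimes>\<^sub>M borel)"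
  shows "(\<integral>\<^sup>+s\<in>{0..t}. (\<integral>\<^sup>+u. ennreal ((1 - sqrt (Y \<omega> s u))\<^sup>2) \<partial>K \<omega> s) \<partial>lebesgue) \<le>
    (\<integral>\<^sup>+s\<in>{0..t}. (\<integral>\<^sup>+u. 1 \<partial>K \<omega> s) \<partial>lebesgue) +
    (\<integral>\<^sup>+s\<in>{0..t}. (\<integral>\<^sup>+u. ennreal (Y \<omega> s u) \<partial>K \<omega> s) \<partial>lebesgue)"
proof -
  have inner: "(\<integral>\<^sup>+u. ennreal ((1 - sqrt (Y \<omega> s u))\<^sup>2) \<partial>K \<omega> s) \<le>
      (\<integral>\<^sup>+u. 1 \<partial>K \<omega> s) + (\<integral>\<^sup>+u. ennreal (Y \<omega> s u) \<partial>K \<omega> s)" if s: "0 \<le> s" for s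
  proof -
    have "(\<omega>, s) \<in> space (predictable_field M F)" using \<omega> s by simp
    from measurable_Pair2[OF Ym this] have "Y \<omega> s \<in> borel_measurable borel" by simp
    moreover have "sets (K \<omega> s) = sets borel" using K \<omega> s by (auto simp: time_kernel_def)
    ultimately have Ys: "Y \<omega> s \<in> borel_measurable (K \<omega> s)"
      by (simp cong: measurable_cong_sets)
    have "ennreal ((1 - sqrt (Y \<omega> s u))\<^sup>2) \<le> 1 + ennreal (Y \<omega> s u)" for u
    proof -
      have "(1 - sqrt (Y \<omega> s u))\<^sup>2 \<le> 1 + Y \<omega> s u"
        using Y[OF s, of u] by (simp add: power2_diff)
      then have "ennreal ((1 - sqrt (Y \<omega> s u))\<^sup>2) \<le> ennreal (1 + Y \<omega> s u)"
        by (rule ennreal_leI)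
      then show ?thesis using Y[OF s, of u] by simp
    qed
    then have "(\<integral>\<^sup>+u. ennreal ((1 - sqrt (Y \<omega> s u))\<^sup>2) \<partial>K \<omega> s) \<le>
        (\<integral>\<^sup>+u. 1 + ennreal (Y \<omega> s u) \<partial>K \<omega> s)"
      by (intro nn_integral_mono)
    also have "\<dots> = (\<integral>\<^sup>+u. 1 \<partial>K \<omega> s) + (\<integral>\<^sup>+u. ennreal (Y \<omega> s u) \<partial>K \<omega> s)"
      using Ys by (intro nn_integral_add) auto
    finally show ?thesis .
  qed
  have "(\<integral>\<^sup>+s\<in>{0..t}. (\<integral>\<^sup>+u. ennreal ((1 - sqrt (Y \<omega> s u))\<^sup>2) \<partial>K \<omega> s) \<partial>lebesgue) \<le>
    (\<integral>\<^sup>+s. (\<integral>\<^sup>+u. 1 \<partial>K \<omega> s) * indicator {0..t} s +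
         (\<integral>\<^sup>+u. ennreal (Y \<omega> s u) \<partial>K \<omega> s) * indicator {0..t} s \<partial>lebesgue)"
    using inner by (intro nn_integral_mono) (auto split: split_indicator)
  \<comment> \<open>The integrals over marks add up exactly because \<open>Y \<omega> s\<close> is
    measurable in \<open>u\<close>. In time only the first summand is known to be measurable, so
    subadditivity takes the place of additivity.\<close>
  also have "\<dots> \<le> (\<integral>\<^sup>+s\<in>{0..t}. (\<integral>\<^sup>+u. 1 \<partial>K \<omega> s) \<partial>lebesgue) +
    (\<integral>\<^sup>+s\<in>{0..t}. (\<integral>\<^sup>+u. ennreal (Y \<omega> s u) \<partial>K \<omega> s) \<partial>lebesgue)"
    by (rule nn_integral_add_le[OF time_kernel_mass_measurable[OF K \<omega>]])
  finally show ?thesis .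
qed

text \<open>The integral increases with its upper limit, so no time before \<open>t\<close> can
  reach level \<open>n\<close>. If the level is never reached, the infimum of the empty set is
  \<top>.\<close>

lemma le_xi:
  assumes "(\<integral>\<^sup>+s\<in>{0..t}. (\<integral>\<^sup>+u. ennreal ((1 - sqrt (Y \<omega> s u))\<^sup>2) \<partial>K \<omega> s) \<partial>lebesgue) < of_nat n"
  shows "ennreal t \<le> xi Y K n \<omega>"
  unfolding xi_def
proof (rule Inf_greatest, clarify)
  let ?h = "\<lambda>t. \<integral>\<^sup>+s\<in>{0..t}. (\<integral>\<^sup>+u. ennreal ((1 - sqrt (Y \<omega> s u))\<^sup>2) \<partial>K \<omega> s) \<partial>lebesgue"
  fix r assume r: "of_nat n \<le> ?h r"
  have "t \<le> r"
  proof (rule ccontr)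
    assume "\<not> t \<le> r"
    then have "?h r \<le> ?h t"
      by (intro nn_integral_mono) (auto split: split_indicator)
    with r assms show False by auto
  qed
  then show "ennreal t \<le> ennreal r" by (rule ennreal_leI)
qed


section \<open>From the stopped densities to the density at all times\<close>

theorem theorem3p2:
  fixes M P' H :: "'a measure"
    and F :: "real \<Rightarrow> 'a measure"
    and T :: "nat \<Rightarrow> 'a \<Rightarrow> ennreal"
    and U :: "nat \<Rightarrow> 'a \<Rightarrow> real ^ 'd"
    and \<nu> :: "'a \<Rightarrow> (real \<times> (real ^ 'd)) measure"
    and K :: "'a \<Rightarrow> real \<Rightarrow> (real ^ 'd) measure"
    and L :: "real \<Rightarrow> 'a \<Rightarrow> real"
    and Y :: "'a \<Rightarrow> real \<Rightarrow> real ^ 'd \<Rightarrow> real"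
  assumes "prob_space M"
    and "usual_conditions M F"
    and "marked_point_process M F T U"
    and "non_explosive M T"
    and "is_compensator M F (mpp_measure T U) \<nu>"
    and "subalgebra M H"
    and A1: "sets M = sigma_sets (space M) (\<Union>t\<in>{0..}. sets (F t))"
            "smallest_filtration M H (mpp_measure T U) F"
    and A2: "time_kernel M K"
            "has_time_kernel M \<nu> (\<lambda>_ _ _. 1) K"
    and "prob_space P'" "sets P' = sets M"
    and "absolutely_continuous M P'" "absolutely_continuous P' M"
    and "density_process M P' F L"
    and "measure_change_function M P' F T U K L Y"
  shows "(AE \<omega> in P'. \<forall>t>0.
            (\<integral>\<^sup>+s\<in>{0..t}. (\<integral>\<^sup>+u. ennreal (Y \<omega> s u) \<partial>K \<omega> s) \<partial>lebesgue) < \<infinity>) \<and>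
         (AE \<omega> in M. \<forall>t\<ge>0. L t \<omega> =
            exp (- (LINT s:{0..t}|lebesgue. (LINT u|K \<omega> s. (Y \<omega> s u - 1)))) *
            (\<Prod>i | T i \<omega> \<le> ennreal t. Y \<omega> (enn2real (T i \<omega>)) (U i \<omega>)))"
proof -
  have F: "time_filtration M F"
    using assms(2) by (simp add: usual_conditions_def)
  have spP': "space P' = space M"
    using \<open>sets P' = sets M\<close> by (rule sets_eq_imp_space_eq)
  have AE_P': "AE \<omega> in P'. Q \<omega>" if "AE \<omega> in M. Q \<omega>" for Q
    using absolutely_continuous_AE[OF \<open>sets P' = sets M\<close> \<open>absolutely_continuous M P'\<close> that] .
  \<comment> \<open>This direction carries the finiteness of the \<open>Y\<close> integral, obtained
    under \<open>P'\<close>, back to \<open>M\<close>, where the formulas for \<open>L\<close>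
    hold.\<close>
  have AE_M: "AE \<omega> in M. Q \<omega>" if "AE \<omega> in P'. Q \<omega>" for Q
    using absolutely_continuous_AE[OF \<open>sets P' = sets M\<close>[symmetric]
        \<open>absolutely_continuous P' M\<close> that] .
  note Y = \<open>measure_change_function M P' F T U K L Y\<close>[unfolded measure_change_function_def]
  from Y obtain \<nu>' where \<nu>': "is_compensator P' F (mpp_measure T U) \<nu>'" "has_time_kernel P' \<nu>' Y K"
    by blast
  \<comment> \<open>The filtration and the point process see the measure only through its space and
    sets; non-explosion is an almost sure property and passes to \<open>P'\<close> by
    \<open>AE_P'\<close>.\<close>
  have "time_filtration P' F"
    using F spP' \<open>sets P' = sets M\<close> by (simp add: time_filtration_def subalgebra_def)
  moreover have "marked_point_process P' F T U"
    using assms(3) spP' \<open>sets P' = sets M\<close>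
    by (simp add: marked_point_process_def cong: measurable_cong_sets)
  moreover have "non_explosive P' T"
    using AE_P' assms(4) by (simp add: non_explosive_def)
  ultimately have "AE \<omega> in P'. \<forall>t. emeasure (\<nu>' \<omega>) ({0..t} \<times> UNIV) < \<infinity>"
    using \<open>prob_space P'\<close> \<nu>'(1) by (intro compensator_finite_on_compacts)
  with has_time_kernel_rectangle[OF \<nu>'(2)]
  have fin_Y: "AE \<omega> in P'. \<forall>t.
      (\<integral>\<^sup>+s\<in>{0..t}. (\<integral>\<^sup>+u. ennreal (Y \<omega> s u) \<partial>K \<omega> s) \<partial>lebesgue) < \<infinity>"
    by eventually_elim simp
  have "AE \<omega> in M. \<forall>t. emeasure (\<nu> \<omega>) ({0..t} \<times> UNIV) < \<infinity>"
    using assms F by (intro compensator_finite_on_compacts)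
  \<comment> \<open>With density constantly 1, the rectangle formula gives the mass of
    \<open>K\<close> itself.\<close>
  with has_time_kernel_rectangle[OF A2(2)]
  have fin_1: "AE \<omega> in M. \<forall>t. (\<integral>\<^sup>+s\<in>{0..t}. (\<integral>\<^sup>+u. 1 \<partial>K \<omega> s) \<partial>lebesgue) < \<infinity>"
    by eventually_elim simp
  have dens: "AE \<omega> in M. \<forall>n\<ge>1. \<forall>t\<ge>0. ennreal t \<le> xi Y K n \<omega> \<longrightarrow>
        L t \<omega> = stopped_density T U Y K n t \<omega>"
    using Y by blast
  have "AE \<omega> in M. \<forall>t\<ge>0. L t \<omega> =
      exp (- (LINT s:{0..t}|lebesgue. (LINT u|K \<omega> s. (Y \<omega> s u - 1)))) *
      (\<Prod>i | T i \<omega> \<le> ennreal t. Y \<omega> (enn2real (T i \<omega>)) (U i \<omega>))"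
    using dens fin_1 AE_M[OF fin_Y] AE_space
  proof eventually_elim
    case (elim \<omega>)
    show ?case
    proof (intro allI impI)
      fix t :: real assume t: "0 \<le> t"
      let ?h = "\<integral>\<^sup>+s\<in>{0..t}. (\<integral>\<^sup>+u. ennreal ((1 - sqrt (Y \<omega> s u))\<^sup>2) \<partial>K \<omega> s) \<partial>lebesgue"
      have "?h \<le> (\<integral>\<^sup>+s\<in>{0..t}. (\<integral>\<^sup>+u. 1 \<partial>K \<omega> s) \<partial>lebesgue) +
          (\<integral>\<^sup>+s\<in>{0..t}. (\<integral>\<^sup>+u. ennreal (Y \<omega> s u) \<partial>K \<omega> s) \<partial>lebesgue)"
        using Y elim(4) by (intro hellinger_integral_le[OF A2(1)]) auto
      also have "\<dots> < top"
        using elim(2,3) by simp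
      \<comment> \<open>The level \<open>n\<close> depends on \<omega> and \<open>t\<close>, which
        is harmless since \<open>dens\<close> holds for all levels and times outside one null
        set.\<close>
      finally obtain n where n: "?h < of_nat n"
        using ennreal_Ex_less_of_nat by blast
      then have xi: "ennreal t \<le> xi Y K n \<omega>"
        by (rule le_xi)
      \<comment> \<open>Level 0 is excluded because nothing lies strictly below 0.\<close>
      have "1 \<le> n" using n by (cases n) auto
      then have "L t \<omega> = stopped_density T U Y K n t \<omega>"
        using elim(1) t xi by blast
      then show "L t \<omega> = exp (- (LINT s:{0..t}|lebesgue. (LINT u|K \<omega> s. (Y \<omega> s u - 1)))) *
          (\<Prod>i | T i \<omega> \<le> ennreal t. Y \<omega> (enn2real (T i \<omega>)) (U i \<omega>))"
        using t xi by (simp add: stopped_density_def min_absorb1)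
    qed
  qed
  with fin_Y show ?thesis by auto
qed

end
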